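(* Let $T$ be an $n$-vertex rooted tree. Then $$\frac{2}{n}\,LI(T)\le \rho_L(T)\le \max_{1\le i\le n} L_i(T).$$ Equality holds in the lower bound if and only if $n\le 2$.
   Context: A rooted tree is a finite tree with a distinguished vertex (the root). The level $l(v)$ of a vertex $v$ is its distance from the root. For a rooted tree $T$ with vertices $v_1,\dots,v_n$, the level matrix $L(T)=(l_{ij})$ is the $n\times n$ real symmetric matrix with $l_{ij}=|l(v_i)-l(v_j)|$. The level spectral radius $\rho_L(T)$ is the largest absolute value of an eigenvalue of $L(T)$. Set $L_i(T)=\sum_{j=1}^n l_{ij}$ (the $i$-th row sum). The level index $LI(T)$ is half the sum of all entries of $L(T)$. *)

theory Defs
  imports "Graph_Theory.Digraph_Component" "Jordan_Normal_Form.Spectral_Radius"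
begin

text \<open>
  Simple undirected graphs are represented by the locale \<open>graph\<close> (finite, loop-free, symmetric
  digraphs without parallel arcs). The library's \<open>forest\<close> and \<open>tree\<close> are not usable here: they
  exclude all directed cycles, hence also the closed walk \<open>u, v, u\<close> along an edge of a symmetric
  digraph. In a symmetric digraph without parallel arcs, the directed cycles of length at least 3
  are exactly the cycles of the underlying undirected graph (with a direction of traversal).
  Note that \<open>connected\<close> includes non-emptiness of the vertex set.
\<close>

definition undirected_tree :: "('a, 'b) pre_digraph \<Rightarrow> bool" where
  "undirected_tree T \<longleftrightarrow>
     graph T \<and> Digraph_Component.connected T \<and>
     \<not> (\<exists>p. pre_digraph.cycle T p \<and> 3 \<le> length p)"

definition rooted_tree :: "('a, 'b) pre_digraph \<Rightarrow> 'a \<Rightarrow> bool" where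
  "rooted_tree T r \<longleftrightarrow> undirected_tree T \<and> r \<in> verts T"

definition graph_distance :: "('a, 'b) pre_digraph \<Rightarrow> 'a \<Rightarrow> 'a \<Rightarrow> nat" where
  "graph_distance G u w = (LEAST k. \<exists>p. pre_digraph.apath G u p w \<and> length p = k)"

definition level :: "('a, 'b) pre_digraph \<Rightarrow> 'a \<Rightarrow> 'a \<Rightarrow> nat" where
  "level T r x = graph_distance T r x"

text \<open>
  In the following, \<open>v 0, \<dots>, v (n - 1)\<close> is meant to be an enumeration of the vertices of \<open>T\<close>.
\<close>

definition level_matrix ::
  "('a, 'b) pre_digraph \<Rightarrow> 'a \<Rightarrow> nat \<Rightarrow> (nat \<Rightarrow> 'a) \<Rightarrow> real mat" where
  "level_matrix T r n v =
     mat n n (\<lambda>(i, j). \<bar>real (level T r (v i)) - real (level T r (v j))\<bar>)"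

definition level_spectral_radius ::
  "('a, 'b) pre_digraph \<Rightarrow> 'a \<Rightarrow> nat \<Rightarrow> (nat \<Rightarrow> 'a) \<Rightarrow> real" where
  "level_spectral_radius T r n v =
     spectral_radius (map_mat complex_of_real (level_matrix T r n v))"

definition level_row_sum ::
  "('a, 'b) pre_digraph \<Rightarrow> 'a \<Rightarrow> nat \<Rightarrow> (nat \<Rightarrow> 'a) \<Rightarrow> nat \<Rightarrow> real" where
  "level_row_sum T r n v i = (\<Sum>j<n. level_matrix T r n v $$ (i, j))"

definition level_index ::
  "('a, 'b) pre_digraph \<Rightarrow> 'a \<Rightarrow> nat \<Rightarrow> (nat \<Rightarrow> 'a) \<Rightarrow> real" where
  "level_index T r n v = (\<Sum>i<n. \<Sum>j<n. level_matrix T r n v $$ (i, j)) / 2"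

end

theory Submission
  imports Defs
begin

text \<open>
  Write \<open>s i\<close> for the row sums of the level matrix \<open>L\<close>, \<open>m\<close> for their mean and \<open>\<rho>\<close> for the spectral
  radius. Since \<open>m\<close> equals \<open>2 / n\<close> times the level index, the lower bound reads \<open>m \<le> \<rho>\<close>. The upper
  bound holds for every matrix, with absolute row sums: compare the two sides of the eigenvalue
  equation in a coordinate where the eigenvector is largest (\<open>spectral_radius_le_row_sum\<close>).

  For the lower bound, a real symmetric matrix stretches Euclidean length by at most \<open>\<rho>\<close>
  (\<open>symmetric_mat_norm_bound\<close>). Instead of diagonalising, the proof uses that symmetry makes
  \<open>k \<mapsto> |A\<^sup>k u|\<^sup>2\<close> convex, so that one lengthening step would force this sequence to be unbounded,
  while the powers of \<open>A\<close> stay bounded if \<open>\<rho> < 1\<close>; the general case follows by scaling. Applied to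
  the all-ones vector, whose image is the vector of row sums, the estimate becomes
  \<open>(\<Sum>i<n. (s i - m)\<^sup>2) \<le> n (\<rho>\<^sup>2 - m\<^sup>2)\<close> (\<open>row_sum_variance_le\<close>). This yields \<open>m \<le> \<rho>\<close>, and it shows
  that equality forces all row sums to be equal.

  In a rooted tree the root is the only vertex of level 0, and any other vertex comes with a vertex
  of level 1. Passing from the root to level 1 brings every vertex except the root closer by one, so
  the two row sums differ by \<open>n - 2\<close> (\<open>level_row_sum_root_minus_level_1\<close>). Hence equality fails for
  \<open>n > 2\<close>. For \<open>n \<le> 2\<close> a symmetric matrix with zero diagonal has constant row sums, and the lower
  and the upper bound coincide.
\<close>

section \<open>Spectral radius bounds for real symmetric matrices\<close>

text \<open>
  Powers are defined with the new factor on the right, whereas iterating \<open>A\<close> on a vector puts it on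
  the left.
\<close>

lemma pow_mat_Suc_mult_vec:
  fixes A :: "'a :: comm_semiring_1 mat"
  assumes A: "A \<in> carrier_mat n n" and u: "u \<in> carrier_vec n"
  shows "A ^\<^sub>m Suc k *\<^sub>v u = A *\<^sub>v (A ^\<^sub>m k *\<^sub>v u)"
  using u
proof (induction k arbitrary: u)
  case 0
  then show ?case using A by simp
next
  case (Suc k)
  have Au: "A *\<^sub>v u \<in> carrier_vec n" using A Suc.prems by simp
  have Ak: "A ^\<^sub>m k \<in> carrier_mat n n" "A ^\<^sub>m Suc k \<in> carrier_mat n n"
    using A by (auto simp del: pow_mat.simps)
  have "A ^\<^sub>m Suc (Suc k) *\<^sub>v u = A ^\<^sub>m Suc k *\<^sub>v (A *\<^sub>v u)"
    using assoc_mult_mat_vec[OF Ak(2) A Suc.prems] by simp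
  also have "\<dots> = A *\<^sub>v (A ^\<^sub>m k *\<^sub>v (A *\<^sub>v u))" by (rule Suc.IH[OF Au])
  also have "A ^\<^sub>m k *\<^sub>v (A *\<^sub>v u) = A ^\<^sub>m Suc k *\<^sub>v u"
    using assoc_mult_mat_vec[OF Ak(1) A Suc.prems] by simp
  finally show ?case .
qed

lemma scalar_prod_self_nonneg: "0 \<le> (u :: real vec) \<bullet> u"
  by (simp add: scalar_prod_def sum_nonneg)

lemma two_scalar_prod_le:
  fixes x y :: "real vec"
  assumes "x \<in> carrier_vec n" "y \<in> carrier_vec n"
  shows "2 * (x \<bullet> y) \<le> x \<bullet> x + y \<bullet> y"
proof -
  have "x \<bullet> x + y \<bullet> y - 2 * (x \<bullet> y) = (\<Sum>i<n. (x $ i - y $ i)\<^sup>2)"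
    using assms
    by (simp add: scalar_prod_def atLeast0LessThan sum_distrib_left power2_eq_square
        algebra_simps sum.distrib sum_subtractf)
  then show ?thesis
    by (smt (verit) sum_nonneg zero_le_power2)
qed

lemma norm_eigenvalue_le_spectral_radius:
  fixes A :: "complex mat"
  assumes A: "A \<in> carrier_mat n n" and v: "v \<in> carrier_vec n" "v \<noteq> 0\<^sub>v n"
    and ev: "A *\<^sub>v v = c \<cdot>\<^sub>v v" and n: "0 < n"
  shows "norm c \<le> spectral_radius A"
proof -
  have "c \<in> spectrum A"
    using A v ev unfolding spectrum_def eigenvalue_def eigenvector_def by auto
  then show ?thesis using spectral_radius_mem_max(2)[OF A n] by blast
qed

lemma spectral_radius_eigenvector:
  fixes A :: "complex mat"
  assumes A: "A \<in> carrier_mat n n" and n: "0 < n"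
  obtains v c where "v \<in> carrier_vec n" "v \<noteq> 0\<^sub>v n" "A *\<^sub>v v = c \<cdot>\<^sub>v v"
    "norm c = spectral_radius A"
  using spectral_radius_mem_max(1)[OF A n] A that
  unfolding spectrum_def eigenvalue_def eigenvector_def by auto

lemma spectral_radius_nonneg:
  assumes "A \<in> carrier_mat n n" and "0 < n"
  shows "0 \<le> spectral_radius A"
  using spectral_radius_mem_max(1)[OF assms] by auto

lemma spectral_radius_smult_inverse_less_1:
  fixes A :: "complex mat"
  assumes A: "A \<in> carrier_mat n n" and n: "0 < n"
    and R: "spectral_radius A < R"
  shows "spectral_radius (complex_of_real (inverse R) \<cdot>\<^sub>m A) < 1"
proof -
  have R0: "0 < R" using spectral_radius_nonneg[OF A n] R by simp
  let ?B = "complex_of_real (inverse R) \<cdot>\<^sub>m A"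
  have B: "?B \<in> carrier_mat n n" using A by simp
  from spectral_radius_eigenvector[OF B n] obtain v c where
    v: "v \<in> carrier_vec n" "v \<noteq> 0\<^sub>v n" and c: "?B *\<^sub>v v = c \<cdot>\<^sub>v v" "norm c = spectral_radius ?B"
    by blast
  have "A *\<^sub>v v = (complex_of_real R * c) \<cdot>\<^sub>v v"
  proof (rule eq_vecI)
    fix i assume "i < dim_vec ((complex_of_real R * c) \<cdot>\<^sub>v v)"
    then have i: "i < n" using v by simp
    have "(?B *\<^sub>v v) $ i = complex_of_real (inverse R) * (A *\<^sub>v v) $ i"
      using i A v by (simp add: scalar_prod_def sum_distrib_left mult.assoc)
    then show "(A *\<^sub>v v) $ i = ((complex_of_real R * c) \<cdot>\<^sub>v v) $ i"
      using i v R0 c(1) by (simp add: field_simps)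
  qed (use A v in auto)
  from norm_eigenvalue_le_spectral_radius[OF A v this n] have "R * norm c \<le> spectral_radius A"
    using R0 by (simp add: norm_mult)
  then show ?thesis using R R0 c(2)
    by (metis less_le_not_le linorder_not_less mult_le_cancel_left1 order_trans)
qed

text \<open>
  If \<open>A\<close> lengthened \<open>u\<close>, the squared lengths \<open>N k\<close> of the iterates \<open>w k = A\<^sup>k u\<close> would grow at least
  linearly: by symmetry \<open>N (k + 1)\<close> is the scalar product of \<open>w k\<close> and \<open>w (k + 2)\<close>, hence at most the
  mean of \<open>N k\<close> and \<open>N (k + 2)\<close>, which makes \<open>N\<close> convex. By the Jordan normal form, however, the
  powers of a matrix of spectral radius below 1 are bounded.
\<close>

lemma symmetric_mat_contraction:
  fixes A :: "real mat"
  assumes A: "A \<in> carrier_mat n n" and sym: "transpose_mat A = A"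
    and u: "u \<in> carrier_vec n"
    and rho: "spectral_radius (map_mat complex_of_real A) < 1"
  shows "(A *\<^sub>v u) \<bullet> (A *\<^sub>v u) \<le> u \<bullet> u"
proof (rule ccontr)
  define w where "w k = A ^\<^sub>m k *\<^sub>v u" for k
  define N where "N k = w k \<bullet> w k" for k
  assume "\<not> ?thesis"
  then have N01: "N 0 < N 1"
    using A u by (simp add: N_def w_def)
  have Ak: "A ^\<^sub>m k \<in> carrier_mat n n" for k using A by simp
  have w: "w k \<in> carrier_vec n" for k unfolding w_def by (rule mult_mat_vec_carrier[OF Ak u])
  have w_Suc: "w (Suc k) = A *\<^sub>v w k" for k
    unfolding w_def by (rule pow_mat_Suc_mult_vec[OF A u])
  have convex: "2 * N (Suc k) \<le> N k + N (Suc (Suc k))" for k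
  proof -
    have "N (Suc k) = w k \<bullet> w (Suc (Suc k))"
      using transpose_vec_mult_scalar[OF A w[of "Suc k"] w[of k]] by (simp add: N_def w_Suc sym)
    then show ?thesis using two_scalar_prod_le[OF w[of k] w[of "Suc (Suc k)"]]
      by (simp add: N_def)
  qed
  have step: "N 1 - N 0 \<le> N (Suc k) - N k" for k
  proof (induction k)
    case (Suc k)
    then show ?case using convex[of k] by linarith
  qed simp
  have linear: "real k * (N 1 - N 0) \<le> N k" for k
  proof (induction k)
    case 0
    then show ?case by (simp add: N_def scalar_prod_self_nonneg)
  next
    case (Suc k)
    then show ?case using step[of k] by (simp add: algebra_simps)
  qed
  obtain c where c: "\<And>k. norm_bound (map_mat complex_of_real A ^\<^sub>m k) c"
    using spectral_radius_jnf_norm_bound_less_1_upper_triangular[OF _ rho] A by fastforce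
  have entry: "\<bar>(A ^\<^sub>m k) $$ (i, j)\<bar> \<le> c" if "i < n" "j < n" for i j k
  proof -
    have "norm ((map_mat complex_of_real (A ^\<^sub>m k)) $$ (i, j)) \<le> c"
      using c[of k] that A Ak[of k]
      unfolding of_real_hom.mat_hom_pow[OF A] norm_bound_def by simp
    then show ?thesis using that A by simp
  qed
  define S where "S = (\<Sum>j<n. c * \<bar>u $ j\<bar>)"
  have wi: "\<bar>w k $ i\<bar> \<le> S" if "i < n" for k i
  proof -
    have "w k $ i = (\<Sum>j<n. (A ^\<^sub>m k) $$ (i, j) * u $ j)"
      using that Ak[of k] u A by (simp add: w_def scalar_prod_def atLeast0LessThan)
    also have "\<bar>\<dots>\<bar> \<le> S" unfolding S_def
      by (rule order_trans[OF sum_abs])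
        (auto intro!: sum_mono mult_right_mono entry that simp: abs_mult)
    finally show ?thesis .
  qed
  have bounded: "N k \<le> real n * S\<^sup>2" for k
  proof -
    have "N k = (\<Sum>i<n. (w k $ i)\<^sup>2)"
      using w[of k] by (simp add: N_def scalar_prod_def atLeast0LessThan power2_eq_square)
    also have "\<dots> \<le> (\<Sum>i<n. S\<^sup>2)"
      by (rule sum_mono) (use wi in \<open>metis lessThan_iff abs_ge_zero power2_abs power_mono\<close>)
    finally show ?thesis by simp
  qed
  \<comment> \<open>linear growth with positive slope \<open>N 1 - N 0\<close> beats the uniform bound\<close>
  obtain k where "real n * S\<^sup>2 < real k * (N 1 - N 0)"
    using ex_less_of_nat_mult[of "N 1 - N 0"] N01 by auto
  then show False using linear[of k] bounded[of k] by linarith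
qed

text \<open>
  For every \<open>R > \<rho>\<close> the matrix \<open>A / R\<close> is a contraction. The bound for \<open>\<rho>\<close> itself, which may be 0,
  is the limit \<open>R \<rightarrow> \<rho>\<close>.
\<close>

lemma symmetric_mat_norm_bound:
  fixes A :: "real mat"
  assumes A: "A \<in> carrier_mat n n" and n: "0 < n" and sym: "transpose_mat A = A"
    and u: "u \<in> carrier_vec n"
  defines "\<rho> \<equiv> spectral_radius (map_mat complex_of_real A)"
  shows "(A *\<^sub>v u) \<bullet> (A *\<^sub>v u) \<le> \<rho>\<^sup>2 * (u \<bullet> u)"
proof -
  let ?C = "map_mat complex_of_real A"
  have C: "?C \<in> carrier_mat n n" using A by simp
  have rho0: "0 \<le> \<rho>" unfolding \<rho>_def by (rule spectral_radius_nonneg[OF C n])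
  have scaled: "(A *\<^sub>v u) \<bullet> (A *\<^sub>v u) \<le> R\<^sup>2 * (u \<bullet> u)" if R: "\<rho> < R" for R
  proof -
    let ?B = "inverse R \<cdot>\<^sub>m A"
    have R0: "0 < R" using rho0 R by simp
    have B: "?B \<in> carrier_mat n n" using A by simp
    have symB: "transpose_mat ?B = ?B"
    proof (rule eq_matI)
      fix i j assume "i < dim_row ?B" "j < dim_col ?B"
      then show "transpose_mat ?B $$ (i, j) = ?B $$ (i, j)"
        using A arg_cong[OF sym, of "\<lambda>M. M $$ (i, j)"] by simp
    qed (use A in auto)
    have "map_mat complex_of_real ?B = complex_of_real (inverse R) \<cdot>\<^sub>m ?C"
      by (rule eq_matI) auto
    then have "spectral_radius (map_mat complex_of_real ?B) < 1"
      using spectral_radius_smult_inverse_less_1[OF C n] R by (simp add: \<rho>_def)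
    from symmetric_mat_contraction[OF B symB u this]
    have "(?B *\<^sub>v u) \<bullet> (?B *\<^sub>v u) \<le> u \<bullet> u" .
    moreover have "?B *\<^sub>v u = inverse R \<cdot>\<^sub>v (A *\<^sub>v u)"
      using A u by (intro eq_vecI) (auto simp: scalar_prod_def sum_distrib_left mult.assoc)
    moreover have "A *\<^sub>v u \<in> carrier_vec n" by (rule mult_mat_vec_carrier[OF A u])
    ultimately have "inverse R * (inverse R * ((A *\<^sub>v u) \<bullet> (A *\<^sub>v u))) \<le> u \<bullet> u"
      by simp
    then show ?thesis using R0 by (simp add: field_simps power2_eq_square)
  qed
  have "((\<lambda>R. R\<^sup>2 * (u \<bullet> u)) \<longlongrightarrow> \<rho>\<^sup>2 * (u \<bullet> u)) (at_right \<rho>)"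
    by (intro tendsto_intros)
  then show ?thesis
    by (rule tendsto_lowerbound)
      (auto intro: eventually_mono[OF eventually_at_right_less] scaled)
qed

text \<open>
  The norm bound for the all-ones vector says that the mean of the squared row sums is at most
  \<open>\<rho>\<^sup>2\<close>. Stating it as a bound on the variance of the row sums gives the inequality \<open>\<bar>m\<bar> \<le> \<rho>\<close> together
  with its equality case.
\<close>

lemma row_sum_variance_le:
  fixes A :: "real mat"
  assumes A: "A \<in> carrier_mat n n" and n: "0 < n" and sym: "transpose_mat A = A"
  defines "\<rho> \<equiv> spectral_radius (map_mat complex_of_real A)"
    and "s \<equiv> \<lambda>i. \<Sum>j<n. A $$ (i, j)"
  defines "m \<equiv> (\<Sum>i<n. s i) / real n"
  shows "(\<Sum>i<n. (s i - m)\<^sup>2) \<le> real n * (\<rho>\<^sup>2 - m\<^sup>2)"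
proof -
  let ?u = "vec n (\<lambda>_. 1 :: real)"
  have Au: "A *\<^sub>v ?u = vec n s"
    using A by (intro eq_vecI) (auto simp: scalar_prod_def s_def atLeast0LessThan)
  have "(\<Sum>i<n. (s i)\<^sup>2) \<le> \<rho>\<^sup>2 * real n"
    using symmetric_mat_norm_bound[OF A n sym, of ?u]
    by (simp add: Au \<rho>_def scalar_prod_def atLeast0LessThan power2_eq_square)
  moreover have "(\<Sum>i<n. (s i - m)\<^sup>2) = (\<Sum>i<n. (s i)\<^sup>2) - real n * m\<^sup>2"
  proof -
    have total: "(\<Sum>i<n. s i) = real n * m" using n by (simp add: m_def)
    have "(\<Sum>i<n. (s i - m)\<^sup>2) = (\<Sum>i<n. (s i)\<^sup>2 + m\<^sup>2 - (2 * m) * s i)"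
      by (simp add: power2_diff mult_ac)
    also have "\<dots> = (\<Sum>i<n. (s i)\<^sup>2) + real n * m\<^sup>2 - (2 * m) * (\<Sum>i<n. s i)"
      by (simp only: sum_subtractf sum.distrib sum_distrib_left) simp
    finally show ?thesis unfolding total by (simp add: power2_eq_square algebra_simps)
  qed
  ultimately show ?thesis by (simp add: algebra_simps)
qed

text \<open>
  In the row where the eigenvector \<open>v\<close> has its entry of largest modulus, the moduli of all entries of
  \<open>v\<close> can be estimated by that one, which is nonzero and cancels.
\<close>

lemma spectral_radius_le_row_sum:
  fixes A :: "complex mat"
  assumes A: "A \<in> carrier_mat n n" and n: "0 < n"
    and b: "\<And>i. i < n \<Longrightarrow> (\<Sum>j<n. norm (A $$ (i, j))) \<le> b"
  shows "spectral_radius A \<le> b"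
proof -
  from spectral_radius_eigenvector[OF A n] obtain v c where
    v: "v \<in> carrier_vec n" "v \<noteq> 0\<^sub>v n" and c: "A *\<^sub>v v = c \<cdot>\<^sub>v v" "norm c = spectral_radius A"
    by blast
  obtain i where i: "i < n" and max: "\<And>j. j < n \<Longrightarrow> norm (v $ j) \<le> norm (v $ i)"
  proof -
    have "Max ((\<lambda>j. norm (v $ j)) ` {..<n}) \<in> (\<lambda>j. norm (v $ j)) ` {..<n}"
      using n by (intro Max_in) auto
    then obtain i where "i < n" "Max ((\<lambda>j. norm (v $ j)) ` {..<n}) = norm (v $ i)" by auto
    then show ?thesis using that by (metis Max_ge finite_imageI finite_lessThan imageI lessThan_iff)
  qed
  have pos: "0 < norm (v $ i)"
  proof (rule ccontr)
    assume "\<not> 0 < norm (v $ i)"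
    then have "v $ j = 0" if "j < n" for j using max[OF that] by (smt (verit) norm_le_zero_iff)
    then have "v = 0\<^sub>v n" using v(1) by (intro eq_vecI) auto
    then show False using v(2) by simp
  qed
  have "c * v $ i = (A *\<^sub>v v) $ i" using c(1) v(1) i by simp
  also have "\<dots> = (\<Sum>j<n. A $$ (i, j) * v $ j)"
    using A v(1) i by (simp add: scalar_prod_def atLeast0LessThan)
  finally have "norm c * norm (v $ i) = norm (\<Sum>j<n. A $$ (i, j) * v $ j)"
    by (metis norm_mult)
  also have "\<dots> \<le> (\<Sum>j<n. norm (A $$ (i, j)) * norm (v $ i))"
    by (rule order_trans[OF norm_sum])
      (auto intro!: sum_mono mult_left_mono max simp: norm_mult)
  also have "\<dots> \<le> b * norm (v $ i)"
    unfolding sum_distrib_right[symmetric] by (intro mult_right_mono b i) simp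
  finally show ?thesis using pos c(2) by simp
qed

section \<open>Levels in a rooted tree\<close>

lemma rooted_tree_shortest_apath:
  assumes T: "rooted_tree T r" and x: "x \<in> verts T"
  shows "\<exists>p. pre_digraph.apath T r p x \<and> length p = level T r x"
proof -
  have g: "graph T" and con: "Digraph_Component.connected T" and r: "r \<in> verts T"
    using T by (auto simp: rooted_tree_def undirected_tree_def)
  interpret graph T by (rule g)
  have "strongly_connected T"
    using symmetric_connected_imp_strongly_connected[OF sym_arcs con] .
  then have "r \<rightarrow>\<^sup>*\<^bsub>T\<^esub> x" using r x by (auto elim: strongly_connectedE)
  then obtain p where "apath r p x" using reachable_apath by blast
  then show ?thesis unfolding level_def graph_distance_def
    by (intro LeastI_ex[of "\<lambda>k. \<exists>p. apath r p x \<and> length p = k"]) auto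
qed

lemma level_le_length_apath:
  assumes "pre_digraph.apath T r p x"
  shows "level T r x \<le> length p"
  unfolding level_def graph_distance_def using assms by (intro Least_le) auto

lemma level_eq_0_iff:
  assumes T: "rooted_tree T r" and x: "x \<in> verts T"
  shows "level T r x = 0 \<longleftrightarrow> x = r"
proof -
  interpret graph T using T by (auto simp: rooted_tree_def undirected_tree_def)
  show ?thesis
  proof
    assume "level T r x = 0"
    then show "x = r"
      using rooted_tree_shortest_apath[OF assms] by (auto simp: apath_Nil_iff)
  next
    assume "x = r"
    then show "level T r x = 0"
      using x level_le_length_apath[of T r "[]" x] by (simp add: apath_Nil_iff)
  qed
qed

text \<open>The second vertex on a path from the root to \<open>x\<close> has level 1.\<close>

lemma exists_level_1:
  assumes T: "rooted_tree T r" and x: "x \<in> verts T" "x \<noteq> r"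
  obtains y where "y \<in> verts T" "level T r y = 1"
proof -
  interpret graph T using T by (auto simp: rooted_tree_def undirected_tree_def)
  obtain p where p: "apath r p x" using rooted_tree_shortest_apath[OF T x(1)] by blast
  then obtain e q where "p = e # q" using x(2) by (cases p) (auto simp: apath_Nil_iff)
  with p have e: "e \<in> arcs T" "tail T e = r" by (auto simp: apath_Cons_iff)
  have y: "head T e \<in> verts T" "head T e \<noteq> r" using e no_loops[OF e(1)] by auto
  have "apath r [e] (head T e)" using e y by (auto simp: apath_Cons_iff apath_Nil_iff)
  then have "level T r (head T e) \<le> 1" using level_le_length_apath by fastforce
  moreover have "level T r (head T e) \<noteq> 0" using level_eq_0_iff[OF T y(1)] y(2) by simp
  ultimately show ?thesis using that y(1) by simp
qed

section \<open>The level spectral radius\<close>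

lemma level_row_sum_eq:
  "i < n \<Longrightarrow> level_row_sum T r n v i =
    (\<Sum>j<n. \<bar>real (level T r (v i)) - real (level T r (v j))\<bar>)"
  by (simp add: level_row_sum_def level_matrix_def)

text \<open>
  Moving from level 0 to level 1 decreases the distance to every positive level by one and
  increases the distance to level 0, which only the root occupies, by one. The difference of the
  row sums is therefore \<open>(n - 1) - 1\<close>.
\<close>

lemma level_row_sum_root_minus_level_1:
  assumes T: "rooted_tree T r" and v: "bij_betw v {..<n} (verts T)"
    and a: "a < n" "v a = r" and b: "b < n" "level T r (v b) = 1"
  shows "level_row_sum T r n v a - level_row_sum T r n v b = real n - 2"
proof -
  let ?l = "\<lambda>j. level T r (v j)"
  have vin: "v j \<in> verts T" if "j < n" for j using v that by (auto simp: bij_betw_def)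
  have zero: "?l j = 0 \<longleftrightarrow> j = a" if "j < n" for j
    using level_eq_0_iff[OF T vin[OF that]] v a that
    by (auto simp: bij_betw_def inj_on_def)
  have "level_row_sum T r n v a - level_row_sum T r n v b
      = (\<Sum>j<n. \<bar>real (?l a) - real (?l j)\<bar> - \<bar>real (?l b) - real (?l j)\<bar>)"
    using a b by (simp add: level_row_sum_eq sum_subtractf)
  also have "\<dots> = (\<Sum>j<n. 1 - (if j = a then 2 else 0))"
  proof (rule sum.cong)
    fix j assume "j \<in> {..<n}"
    then have "?l j = 0 \<longleftrightarrow> j = a" using zero by simp
    moreover have "?l a = 0" using zero[OF a(1)] by simp
    ultimately show "\<bar>real (?l a) - real (?l j)\<bar> - \<bar>real (?l b) - real (?l j)\<bar>
        = 1 - (if j = a then 2 else 0)"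
      using b(2) by (cases "j = a") auto
  qed simp
  also have "\<dots> = real n - 2" using a(1) by (simp add: sum_subtractf)
  finally show ?thesis .
qed

theorem theorem2:
  fixes T :: "('a, 'b) pre_digraph" and r :: 'a and n :: nat and v :: "nat \<Rightarrow> 'a"
  assumes "rooted_tree T r"
    and "card (verts T) = n"
    and "bij_betw v {..<n} (verts T)"
  shows "2 / real n * level_index T r n v \<le> level_spectral_radius T r n v
    \<and> level_spectral_radius T r n v \<le> Max (level_row_sum T r n v ` {..<n})
    \<and> (2 / real n * level_index T r n v = level_spectral_radius T r n v \<longleftrightarrow> n \<le> 2)"
proof -
  let ?A = "level_matrix T r n v" and ?C = "map_mat complex_of_real (level_matrix T r n v)"
  let ?s = "level_row_sum T r n v" and ?\<rho> = "level_spectral_radius T r n v"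
  define m where "m = 2 / real n * level_index T r n v"
  have range_v: "v ` {..<n} = verts T" using assms(3) by (simp add: bij_betw_def)
  have "r \<in> v ` {..<n}" using assms(1) by (simp add: rooted_tree_def range_v)
  then obtain a where a: "a < n" "v a = r" by auto
  have n: "0 < n" using a(1) by simp
  have A: "?A \<in> carrier_mat n n" by (simp add: level_matrix_def)
  have C: "?C \<in> carrier_mat n n" using A by simp
  have sym: "transpose_mat ?A = ?A" by (rule eq_matI) (auto simp: level_matrix_def)
  have rho0: "0 \<le> ?\<rho>" unfolding level_spectral_radius_def by (rule spectral_radius_nonneg[OF C n])
  have m_eq: "m = (\<Sum>i<n. ?s i) / real n"
    by (simp add: m_def level_index_def level_row_sum_def)
  have var: "(\<Sum>i<n. (?s i - m)\<^sup>2) \<le> real n * (?\<rho>\<^sup>2 - m\<^sup>2)"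
    using row_sum_variance_le[OF A n sym]
    by (simp add: m_eq level_row_sum_def level_spectral_radius_def)
  have upper: "?\<rho> \<le> Max (?s ` {..<n})"
    unfolding level_spectral_radius_def
  proof (rule spectral_radius_le_row_sum[OF C n])
    fix i assume i: "i < n"
    have "(\<Sum>j<n. norm (?C $$ (i, j))) = ?s i"
      using i by (simp add: level_row_sum_def level_matrix_def)
    then show "(\<Sum>j<n. norm (?C $$ (i, j))) \<le> Max (?s ` {..<n})" using i by simp
  qed
  have "0 \<le> (\<Sum>i<n. (?s i - m)\<^sup>2)" by (simp add: sum_nonneg)
  then have "0 \<le> real n * (?\<rho>\<^sup>2 - m\<^sup>2)" using var by linarith
  then have "m\<^sup>2 \<le> ?\<rho>\<^sup>2" using n by (simp add: zero_le_mult_iff)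
  then have lower: "m \<le> ?\<rho>" using rho0 by (rule power2_le_imp_le)
  have eq: "m = ?\<rho> \<longleftrightarrow> n \<le> 2"
  proof
    assume "m = ?\<rho>"
    then have "(\<Sum>i<n. (?s i - m)\<^sup>2) = 0" using var by (simp add: sum_nonneg order_antisym)
    then have const: "?s i = m" if "i < n" for i
      using that by (simp add: sum_nonneg_eq_0_iff)
    show "n \<le> 2"
    proof (rule ccontr)
      assume n2: "\<not> n \<le> 2"
      then have "\<not> verts T \<subseteq> {r}"
        using assms(2) card_mono[of "{r}" "verts T"] by auto
      then obtain x where "x \<in> verts T" "x \<noteq> r" by auto
      then obtain y where "y \<in> verts T" and y: "level T r y = 1"
        by (rule exists_level_1[OF assms(1)])
      then have "y \<in> v ` {..<n}" by (simp add: range_v)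
      then obtain b where b: "b < n" "level T r (v b) = 1" using y by auto
      show False
        using level_row_sum_root_minus_level_1[OF assms(1,3) a b] const a(1) b(1) n2 by simp
    qed
  next
    assume "n \<le> 2"
    then have "n = 1 \<or> n = 2" using n by linarith
    define c where "c = ?s 0"
    from \<open>n = 1 \<or> n = 2\<close> have const: "?s i = c" if "i < n" for i
      using that by (auto simp: c_def level_row_sum_eq numeral_2_eq_2 less_Suc_eq)
    have "?s ` {..<n} = {c}" using const n by auto
    then have "?\<rho> \<le> c" using upper by simp
    moreover have "m = c" using const n by (simp add: m_eq)
    ultimately show "m = ?\<rho>" using lower by simp
  qed
  show ?thesis using lower upper eq unfolding m_def by blast
qed

end
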